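(* Let $m=2$, $n=2p$, $X\in\mathcal X^n$, and let $\|f\|=\|f\|_\infty:=\sup_{x\in\mathcal X}|f(x)|$. Then the pure strategy optimal design (PSOD) for $X$ and $\|\cdot\|$ is incomplete blocking.
   Context: There are $n=2p$ subjects with covariates $X=(X_1,\dots,X_n)\in\mathcal X^n$ ($\mathcal X$ an arbitrary set) and two treatments. $\mathcal W$ is the set of assignments $W\in\{1,2\}^n$ with exactly $p$ subjects in each treatment; $u_i=+1$ if $W_i=1$ and $u_i=-1$ if $W_i=2$. For $f:\mathcal X\to\mathbb R$, $B(W,f)=\frac2n\sum_{i=1}^n u_i f(X_i)$. Given a magnitude function $\|\cdot\|$ with values in $\mathbb R\cup\{\infty\}$ on functions $\mathcal X\to\mathbb R$ (with $\|f\|=\infty$ allowed), set $M_{\mathrm P}^2(W)=\max_{\|f\|\le1}B^2(W,f)$. The PSOD draws $W$ uniformly at random from $\arg\min_{W\in\mathcal W}M_{\mathrm P}^2(W)$. Incomplete blocking: subjects are partitioned into disjoint blocks of even size, such that all subjects within a block have equal covariates and different blocks have different covariate values, plus a set of left-over subjects, so that there are as few left-overs as possible, breaking ties uniformly at random about which subject is left over (thus, exactly one subject is left over for each covariate value that occurs an odd number of times). Then complete randomization (a uniformly random split into two equal halves, one per treatment) is applied to each block separately and independently, and also to the set of left-over subjects. *)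

theory Defs
  imports "HOL-Probability.Probability" "HOL-Probability.Product_PMF"
begin

text \<open>
  The subjects are \<open>1, \<dots>, n\<close>; covariates are given by \<open>X :: nat \<Rightarrow> 'x\<close>, of which only the values
  on \<open>{1..n}\<close> matter.  Assignments are extensional functions on \<open>{1..n}\<close>, so that
  distinct functions are distinct assignments.
\<close>

definition assignments :: "nat \<Rightarrow> (nat \<Rightarrow> nat) set" where
  "assignments p = {W \<in> {1..2*p} \<rightarrow>\<^sub>E {1, 2}.
     card {i \<in> {1..2*p}. W i = 1} = p \<and> card {i \<in> {1..2*p}. W i = 2} = p}"

definition treatment_sign :: "nat \<Rightarrow> real" where
  "treatment_sign w = (if w = 1 then 1 else - 1)"

definition imbalance :: "nat \<Rightarrow> (nat \<Rightarrow> 'x) \<Rightarrow> (nat \<Rightarrow> nat) \<Rightarrow> ('x \<Rightarrow> real) \<Rightarrow> real" where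
  "imbalance n X W f = 2 / real n * (\<Sum>i=1..n. treatment_sign (W i) * f (X i))"

text \<open>
  The maximum over the unit ball is written as a supremum in \<open>ereal\<close>, which makes it meaningful
  for every magnitude function and equals the maximum whenever that is attained.
\<close>

definition worst_imbalance_sq ::
  "nat \<Rightarrow> (nat \<Rightarrow> 'x) \<Rightarrow> (('x \<Rightarrow> real) \<Rightarrow> ereal) \<Rightarrow> (nat \<Rightarrow> nat) \<Rightarrow> ereal" where
  "worst_imbalance_sq n X mag W = (SUP f\<in>{f. mag f \<le> 1}. ereal ((imbalance n X W f)\<^sup>2))"

definition psod :: "nat \<Rightarrow> (nat \<Rightarrow> 'x) \<Rightarrow> (('x \<Rightarrow> real) \<Rightarrow> ereal) \<Rightarrow> (nat \<Rightarrow> nat) pmf" where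
  "psod p X mag =
     pmf_of_set {W. is_arg_min (worst_imbalance_sq (2*p) X mag) (\<lambda>W. W \<in> assignments p) W}"

definition sup_magnitude :: "('x \<Rightarrow> real) \<Rightarrow> ereal" where
  "sup_magnitude f = (SUP x. ereal \<bar>f x\<bar>)"

definition complete_randomization :: "nat set \<Rightarrow> (nat \<Rightarrow> nat) pmf" where
  "complete_randomization S =
     pmf_of_set {V \<in> S \<rightarrow>\<^sub>E {1, 2}. card {i \<in> S. V i = 1} = card {i \<in> S. V i = 2}}"

text \<open>
  A blocking is a pair of the set of blocks and the set of left-over subjects.
\<close>

definition is_blocking :: "nat \<Rightarrow> (nat \<Rightarrow> 'x) \<Rightarrow> nat set set \<times> nat set \<Rightarrow> bool" where
  "is_blocking n X = (\<lambda>(Bs, L).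
     L \<subseteq> {1..n} \<and> partition_on ({1..n} - L) Bs \<and>
     (\<forall>b\<in>Bs. even (card b)) \<and>
     (\<forall>b\<in>Bs. \<forall>i\<in>b. \<forall>j\<in>b. X i = X j) \<and>
     (\<forall>b\<in>Bs. \<forall>c\<in>Bs. b \<noteq> c \<longrightarrow> (\<forall>i\<in>b. \<forall>j\<in>c. X i \<noteq> X j)))"

text \<open>
  Since the blocks of a blocking are determined by its left-over set, drawing a blocking uniformly
  from those with fewest left-overs is the same as drawing the left-over set uniformly.
  The pieces of the blocking (its blocks and the left-over set) are then randomized independently,
  and every subject receives the treatment drawn for it within its own piece.
\<close>

definition incomplete_blocking :: "nat \<Rightarrow> (nat \<Rightarrow> 'x) \<Rightarrow> (nat \<Rightarrow> nat) pmf" where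
  "incomplete_blocking n X =
     bind_pmf (pmf_of_set {BL. is_arg_min (\<lambda>(Bs, L). card L) (is_blocking n X) BL})
       (\<lambda>(Bs, L).
          map_pmf (\<lambda>V. \<lambda>i\<in>{1..n}. V (THE c. c \<in> insert L Bs \<and> i \<in> c) i)
            (Pi_pmf (insert L Bs) (\<lambda>_. undefined) complete_randomization))"

text \<open>For the supremum norm the maximum is indeed attained.\<close>

lemma sup_magnitude_le_1_iff: "sup_magnitude f \<le> 1 \<longleftrightarrow> (\<forall>x. \<bar>f x\<bar> \<le> 1)"
  by (auto simp: sup_magnitude_def SUP_le_iff one_ereal_def)

lemma worst_imbalance_sq_sup_attained:
  fixes X :: "nat \<Rightarrow> 'x"
  shows "\<exists>f. sup_magnitude f \<le> 1 \<and>
           worst_imbalance_sq n X sup_magnitude W = ereal ((imbalance n X W f)\<^sup>2)"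
proof -
  define s where "s x = (\<Sum>i\<in>{i \<in> {1..n}. X i = x}. treatment_sign (W i))" for x
  have eq: "(\<Sum>i=1..n. treatment_sign (W i) * f (X i)) = (\<Sum>x\<in>X ` {1..n}. s x * f x)" for f
  proof -
    have "(\<Sum>i=1..n. treatment_sign (W i) * f (X i)) =
      (\<Sum>x\<in>X ` {1..n}. \<Sum>i\<in>{i \<in> {1..n}. X i = x}. treatment_sign (W i) * f (X i))"
      by (rule sum.image_gen) simp
    also have "\<dots> = (\<Sum>x\<in>X ` {1..n}. s x * f x)"
      by (intro sum.cong refl) (simp add: s_def sum_distrib_right)
    finally show ?thesis .
  qed
  define h where "h x = sgn (s x)" for x
  have h: "sup_magnitude h \<le> 1"
    by (auto simp: sup_magnitude_le_1_iff h_def sgn_real_def)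
  have max: "(imbalance n X W g)\<^sup>2 \<le> (imbalance n X W h)\<^sup>2" if g: "sup_magnitude g \<le> 1" for g
  proof -
    have "\<bar>\<Sum>x\<in>X ` {1..n}. s x * g x\<bar> \<le> (\<Sum>x\<in>X ` {1..n}. \<bar>s x * g x\<bar>)"
      by (rule sum_abs)
    also have "\<dots> \<le> (\<Sum>x\<in>X ` {1..n}. s x * h x)"
    proof (rule sum_mono)
      fix x
      have "\<bar>s x * g x\<bar> \<le> \<bar>s x\<bar>"
        using g mult_left_mono[of "\<bar>g x\<bar>" 1 "\<bar>s x\<bar>"] by (simp add: sup_magnitude_le_1_iff abs_mult)
      then show "\<bar>s x * g x\<bar> \<le> s x * h x"
        by (simp add: h_def abs_sgn)
    qed
    finally have "\<bar>imbalance n X W g\<bar> \<le> \<bar>imbalance n X W h\<bar>"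
      unfolding imbalance_def eq abs_mult by (intro mult_left_mono) auto
    then show ?thesis by (simp add: abs_le_square_iff)
  qed
  have "worst_imbalance_sq n X sup_magnitude W = ereal ((imbalance n X W h)\<^sup>2)"
    unfolding worst_imbalance_sq_def using h max by (intro antisym SUP_least SUP_upper) auto
  with h show ?thesis by blast
qed

end

theory Submission
  imports Defs
begin

text \<open>
  Group the subjects into the fibres of the covariate map and, for an assignment \<open>W\<close>, let \<open>s x\<close> be
  the number of subjects with covariate \<open>x\<close> in treatment 1 minus the number in treatment 2.  Both
  designs turn out to be the uniform distribution on the set \<open>fibrewise_balanced\<close> of those
  assignments in \<open>\<W>\<close> for which every \<open>\<bar>s x\<bar>\<close> is the parity (0 or 1) of the size of the fibre of \<open>x\<close>.

  For the PSOD, the function in the unit ball that makes the imbalance largest is \<open>f x = sgn (s x)\<close>,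
  so the criterion is \<open>(2 / n * (\<Sum>x. \<bar>s x\<bar>))\<^sup>2\<close> (\<open>worst_imbalance_sq_sup_magnitude\<close>).  Each summand is
  at least the parity of the fibre, and all these bounds can be attained at once, so the minimisers
  are exactly the assignments attaining all of them (\<open>psod_sup_magnitude_uniform\<close>).

  For incomplete blocking, a blocking is determined by its left-over set \<open>L\<close>, and the minimal
  left-over sets are those containing one subject of each odd fibre and none of each even fibre
  (\<open>minimal_blockings_eq\<close>).  Given \<open>L\<close>, independent complete randomization of the pieces is uniform on
  the assignments that balance \<open>L\<close> and every block.  The number of these is a product of binomial
  coefficients that depends only on the sizes of the fibres (\<open>card_piecewise_balanced_leftover\<close>), and
  they are all in \<open>fibrewise_balanced\<close>.  Conversely, an assignment \<open>W\<close> in \<open>fibrewise_balanced\<close> can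
  arise from \<open>L\<close> iff in every odd fibre the left-over subject is one of the majority treatment of
  \<open>W\<close> there: then the rest of the fibre is balanced, and \<open>L\<close> is balanced because \<open>W\<close> is balanced as
  a whole.  An odd fibre of size \<open>m\<close> has \<open>(m + 1) / 2\<close> such subjects, whichever treatment is the
  majority, so the number of suitable \<open>L\<close> is the same for all \<open>W\<close> (\<open>card_compatible_leftovers\<close>).
  Hence all these \<open>W\<close> are equally likely (\<open>incomplete_blocking_uniform\<close>).
\<close>

section \<open>Uniform distributions and minimisers\<close>

text \<open>
  Both minimisations of the problem, of the imbalance and of the number of left-overs, have a lower
  bound that is known in advance and attained, so that being a minimiser becomes an equation.
\<close>

lemma is_arg_min_iff_eq_lower_bound:
  fixes f :: "'a \<Rightarrow> 'b::linorder"
  assumes "\<And>y. P y \<Longrightarrow> c \<le> f y" and "P z" and "f z = c"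
  shows "is_arg_min f P x \<longleftrightarrow> P x \<and> f x = c"
  unfolding is_arg_min_def using assms(1)[of x] assms(1) assms(2,3) by (auto simp: not_less antisym)

lemma sum_eq_sum_lower_bounds_iff:
  fixes f g :: "'a \<Rightarrow> 'b::ordered_cancel_comm_monoid_add"
  assumes "finite A" and "\<And>x. x \<in> A \<Longrightarrow> g x \<le> f x"
  shows "sum f A = sum g A \<longleftrightarrow> (\<forall>x\<in>A. f x = g x)"
proof
  assume eq: "sum f A = sum g A"
  show "\<forall>x\<in>A. f x = g x"
  proof (rule ccontr)
    assume "\<not> ?thesis"
    then have "\<exists>x\<in>A. g x < f x" using assms(2) by (force simp: less_le)
    then have "sum g A < sum f A" using assms by (intro sum_strict_mono_ex1) auto
    with eq show False by simp
  qed
qed (rule sum.cong, auto)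

lemma pmf_constant_imp_pmf_of_set:
  assumes "finite A" and "set_pmf M \<subseteq> A" and "\<And>x. x \<in> A \<Longrightarrow> pmf M x = c"
  shows "M = pmf_of_set A"
proof -
  have "A \<noteq> {}" using assms(2) set_pmf_not_empty[of M] by blast
  have "1 = sum (pmf M) A"
    using sum_pmf_eq_1[OF assms(1,2)] by simp
  also have "\<dots> = real (card A) * c" using assms(3) by simp
  finally have c: "c = 1 / real (card A)"
    by (metis mult_zero_left nonzero_mult_div_cancel_left zero_neq_one)
  show ?thesis
  proof (rule pmf_eqI)
    fix x
    show "pmf M x = pmf (pmf_of_set A) x"
    proof (cases "x \<in> A")
      case False
      then have "pmf M x = 0" using assms(2) by (auto simp: set_pmf_iff)
      with False show ?thesis using \<open>finite A\<close> \<open>A \<noteq> {}\<close> by simp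
    qed (use \<open>finite A\<close> \<open>A \<noteq> {}\<close> c assms(3) in simp)
  qed
qed

section \<open>Treatment sums and balanced assignments\<close>

definition treatment_sum :: "('i \<Rightarrow> nat) \<Rightarrow> 'i set \<Rightarrow> real" where
  "treatment_sum W S = (\<Sum>i\<in>S. treatment_sign (W i))"

definition balanced_assignments :: "'i set \<Rightarrow> ('i \<Rightarrow> nat) set" where
  "balanced_assignments S = {V \<in> S \<rightarrow>\<^sub>E {1, 2}. treatment_sum V S = 0}"

lemma treatment_sum_cong:
  "(\<And>i. i \<in> S \<Longrightarrow> V i = W i) \<Longrightarrow> treatment_sum V S = treatment_sum W S"
  unfolding treatment_sum_def by (rule sum.cong) auto

lemma treatment_counts:
  assumes "finite S" and "W \<in> S \<rightarrow> {1, 2}"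
  shows "card {i \<in> S. W i = 1} + card {i \<in> S. W i = 2} = card S"
    and "treatment_sum W S = real (card {i \<in> S. W i = 1}) - real (card {i \<in> S. W i = 2})"
proof -
  let ?A = "{i \<in> S. W i = 1}" and ?B = "{i \<in> S. W i = 2}"
  have S: "S = ?A \<union> ?B" and disj: "?A \<inter> ?B = {}" using assms(2) by auto
  have fin: "finite ?A" "finite ?B" using assms(1) by auto
  show "card ?A + card ?B = card S"
    using card_Un_disjoint[OF fin disj] S by simp
  have "treatment_sum W S = treatment_sum W (?A \<union> ?B)" using S by simp
  also have "\<dots> = treatment_sum W ?A + treatment_sum W ?B"
    unfolding treatment_sum_def by (rule sum.union_disjoint[OF fin disj])
  also have "treatment_sum W ?A = (\<Sum>i\<in>?A. 1)"
    unfolding treatment_sum_def by (rule sum.cong) (auto simp: treatment_sign_def)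
  also have "treatment_sum W ?B = (\<Sum>i\<in>?B. - 1)"
    unfolding treatment_sum_def by (rule sum.cong) (auto simp: treatment_sign_def)
  finally show "treatment_sum W S = real (card ?A) - real (card ?B)" by simp
qed

text \<open>
  The two group sizes of an odd set differ, hence differ by at least 1.
\<close>

lemma treatment_sum_ge_parity:
  assumes "finite S" and "W \<in> S \<rightarrow> {1, 2}"
  shows "real (card S mod 2) \<le> \<bar>treatment_sum W S\<bar>"
proof (cases "even (card S)")
  case False
  then have "card {i \<in> S. W i = 1} \<noteq> card {i \<in> S. W i = 2}"
    using treatment_counts(1)[OF assms] by (metis even_add)
  then have "1 \<le> \<bar>treatment_sum W S\<bar>" unfolding treatment_counts(2)[OF assms] by linarith
  with False show ?thesis by (simp add: mod_2_eq_odd)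
qed (simp add: even_iff_mod_2_eq_zero)

lemma complete_randomization_eq:
  assumes "finite S"
  shows "complete_randomization S = pmf_of_set (balanced_assignments S)"
proof -
  have "{V \<in> S \<rightarrow>\<^sub>E {1, 2::nat}. card {i \<in> S. V i = 1} = card {i \<in> S. V i = 2}}
        = balanced_assignments S"
    unfolding balanced_assignments_def
    using treatment_counts(2)[OF assms] by (auto simp: PiE_def)
  then show ?thesis unfolding complete_randomization_def by simp
qed

lemma assignments_eq: "assignments p = balanced_assignments {1..2*p}"
proof -
  have "(card {i \<in> {1..2*p}. W i = 1} = p \<and> card {i \<in> {1..2*p}. W i = 2} = p)
      \<longleftrightarrow> treatment_sum W {1..2*p} = 0" if W: "W \<in> {1..2*p} \<rightarrow>\<^sub>E {1, 2}" for W
    using treatment_counts[of "{1..2*p}" W] W by (auto simp: PiE_def)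
  then show ?thesis unfolding assignments_def balanced_assignments_def by blast
qed

lemma finite_balanced_assignments: "finite S \<Longrightarrow> finite (balanced_assignments S)"
  unfolding balanced_assignments_def
  by (rule finite_subset[of _ "S \<rightarrow>\<^sub>E {1, 2}"]) (auto intro: finite_PiE)

text \<open>
  A balanced assignment is determined by the set of subjects receiving treatment 1, which can be any
  subset of half the size.
\<close>

lemma card_balanced_assignments:
  assumes "finite S" and "even (card S)"
  shows "card (balanced_assignments S) = card S choose (card S div 2)"
proof -
  have "bij_betw (\<lambda>V. {i \<in> S. V i = 1}) (balanced_assignments S)
          {T. T \<subseteq> S \<and> card T = card S div 2}"
  proof (rule bij_betwI[where g = "\<lambda>T. \<lambda>i\<in>S. if i \<in> T then 1 else 2"])
    show "(\<lambda>V. {i \<in> S. V i = 1}) \<in> balanced_assignments S \<rightarrow> {T. T \<subseteq> S \<and> card T = card S div 2}"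
    proof
      fix V assume "V \<in> balanced_assignments S"
      then have "V \<in> S \<rightarrow> {1, 2}" and "treatment_sum V S = 0"
        by (auto simp: balanced_assignments_def)
      then have "card {i \<in> S. V i = 1} = card S div 2"
        using treatment_counts[OF assms(1), of V] by linarith
      then show "{i \<in> S. V i = 1} \<in> {T. T \<subseteq> S \<and> card T = card S div 2}" by auto
    qed
    show "(\<lambda>T. \<lambda>i\<in>S. if i \<in> T then 1 else 2)
        \<in> {T. T \<subseteq> S \<and> card T = card S div 2} \<rightarrow> balanced_assignments S"
    proof
      fix T assume T: "T \<in> {T. T \<subseteq> S \<and> card T = card S div 2}"
      let ?V = "\<lambda>i\<in>S. if i \<in> T then 1 else 2 :: nat"
      have V: "?V \<in> S \<rightarrow>\<^sub>E {1, 2}" by auto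
      have "{i \<in> S. ?V i = 1} = T" using T by auto
      then have "card {i \<in> S. ?V i = 1} = card S div 2" using T by simp
      moreover have "?V \<in> S \<rightarrow> {1, 2}" using V by (simp add: PiE_def)
      note counts = treatment_counts[OF assms(1) this]
      moreover have "card S = 2 * (card S div 2)" using assms(2) by simp
      ultimately have "card {i \<in> S. ?V i = 1} = card {i \<in> S. ?V i = 2}" by linarith
      then have "treatment_sum ?V S = 0" unfolding counts(2) by linarith
      with V show "?V \<in> balanced_assignments S" unfolding balanced_assignments_def by blast
    qed
    fix V assume "V \<in> balanced_assignments S"
    then have V: "V \<in> S \<rightarrow>\<^sub>E {1, 2}" by (simp add: balanced_assignments_def)
    show "(\<lambda>i\<in>S. if i \<in> {i \<in> S. V i = 1} then 1 else 2) = V"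
    proof
      fix i show "(\<lambda>i\<in>S. if i \<in> {i \<in> S. V i = 1} then 1 else 2) i = V i"
        using V by (cases "i \<in> S") (auto simp: PiE_def Pi_def extensional_def)
    qed
  qed auto
  then have "card (balanced_assignments S) = card {T. T \<subseteq> S \<and> card T = card S div 2}"
    by (rule bij_betw_same_card)
  also have "\<dots> = card S choose (card S div 2)" by (rule n_subsets[OF assms(1)])
  finally show ?thesis .
qed

section \<open>Randomizing the pieces of a partition independently\<close>

definition piecewise_balanced :: "'i set \<Rightarrow> 'i set set \<Rightarrow> ('i \<Rightarrow> nat) set" where
  "piecewise_balanced N P = {W \<in> N \<rightarrow>\<^sub>E {1, 2}. \<forall>c\<in>P. treatment_sum W c = 0}"

text \<open>
  Assignments drawn on the pieces of a partition are glued by reading off each subject's treatment in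
  its own piece; restricting to the pieces is the inverse.  The dependent functions have the default
  value \<open>\<lambda>_. undefined\<close> off \<open>P\<close> because that is the default of the product distribution in the design,
  and it need not be equal to \<open>undefined\<close>.  The empty set may be a piece, which covers an empty
  left-over set.
\<close>

lemma glue_balanced_assignments_bij:
  assumes "\<Union>P = N" and "disjoint P"
  shows "bij_betw (\<lambda>V. \<lambda>i\<in>N. V (THE c. c \<in> P \<and> i \<in> c) i)
           (PiE_dflt P (\<lambda>_. undefined) balanced_assignments) (piecewise_balanced N P)"
proof -
  have the: "(THE c. c \<in> P \<and> i \<in> c) = c" if "c \<in> P" "i \<in> c" for c i
    using that assms(2) by (intro the_equality) (auto simp: disjoint_def)
  have sub: "c \<subseteq> N" if "c \<in> P" for c using that assms(1) by auto
  let ?glue = "\<lambda>V. \<lambda>i\<in>N. V (THE c. c \<in> P \<and> i \<in> c) i"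
  let ?split = "\<lambda>W c. if c \<in> P then restrict W c else (\<lambda>_. undefined)"
  show ?thesis
  proof (rule bij_betwI[where g = ?split])
    show "(\<lambda>V. \<lambda>i\<in>N. V (THE c. c \<in> P \<and> i \<in> c) i)
        \<in> PiE_dflt P (\<lambda>_. undefined) balanced_assignments \<rightarrow> piecewise_balanced N P"
    proof
      fix V :: "'a set \<Rightarrow> 'a \<Rightarrow> nat"
      assume V: "V \<in> PiE_dflt P (\<lambda>_. undefined) balanced_assignments"
      let ?W = "\<lambda>i\<in>N. V (THE c. c \<in> P \<and> i \<in> c) i"
      have W: "?W i = V c i" if "c \<in> P" "i \<in> c" for c i
        using that sub[OF that(1)] the[OF that] by auto
      have Vc: "V c \<in> balanced_assignments c" if "c \<in> P" for c
        using V that by (auto simp: PiE_dflt_def)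
      have "?W i \<in> {1, 2}" if i: "i \<in> N" for i
      proof -
        obtain c where c: "c \<in> P" "i \<in> c" using i assms(1) by blast
        then have "V c i \<in> {1, 2}" using Vc[OF c(1)] by (auto simp: balanced_assignments_def)
        then show ?thesis by (simp only: W[OF c])
      qed
      then have "?W \<in> N \<rightarrow>\<^sub>E {1, 2}" by auto
      moreover have "treatment_sum ?W c = 0" if c: "c \<in> P" for c
      proof -
        have "treatment_sum ?W c = treatment_sum (V c) c"
          by (rule treatment_sum_cong) (rule W[OF c])
        with Vc[OF c] show ?thesis by (simp add: balanced_assignments_def)
      qed
      ultimately show "?W \<in> piecewise_balanced N P"
        unfolding piecewise_balanced_def by blast
    qed
    show "(\<lambda>W c. if c \<in> P then restrict W c else (\<lambda>_. undefined))
        \<in> piecewise_balanced N P \<rightarrow> PiE_dflt P (\<lambda>_. undefined) balanced_assignments"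
    proof
      fix W :: "'a \<Rightarrow> nat" assume W: "W \<in> piecewise_balanced N P"
      have "restrict W c \<in> balanced_assignments c" if c: "c \<in> P" for c
      proof -
        have "treatment_sum (restrict W c) c = treatment_sum W c"
          by (rule treatment_sum_cong) simp
        moreover have "restrict W c \<in> c \<rightarrow>\<^sub>E {1, 2}"
          using W sub[OF c] by (auto simp: piecewise_balanced_def PiE_def Pi_def)
        ultimately show ?thesis
          using W c by (simp add: piecewise_balanced_def balanced_assignments_def)
      qed
      then show "(\<lambda>c. if c \<in> P then restrict W c else (\<lambda>_. undefined))
          \<in> PiE_dflt P (\<lambda>_. undefined) balanced_assignments" by (simp add: PiE_dflt_def)
    qed
  next
    fix V :: "'a set \<Rightarrow> 'a \<Rightarrow> nat"
    assume V: "V \<in> PiE_dflt P (\<lambda>_. undefined) balanced_assignments"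
    show "?split (?glue V) = V"
    proof
      fix c
      show "?split (?glue V) c = V c"
      proof (cases "c \<in> P")
        case True
        then have "V c \<in> c \<rightarrow>\<^sub>E {1, 2}" using V by (auto simp: PiE_dflt_def balanced_assignments_def)
        then show ?thesis using True sub[OF True] the[OF True]
          by (auto simp: fun_eq_iff PiE_def extensional_def)
      qed (use V in \<open>auto simp: PiE_dflt_def\<close>)
    qed
  next
    fix W :: "'a \<Rightarrow> nat" assume "W \<in> piecewise_balanced N P"
    then have W: "W \<in> extensional N" by (auto simp: piecewise_balanced_def PiE_def)
    show "?glue (?split W) = W"
    proof
      fix i
      show "?glue (?split W) i = W i"
      proof (cases "i \<in> N")
        case True
        then obtain c where c: "c \<in> P" "i \<in> c" using assms(1) by blast
        then show ?thesis using True the[OF c] by simp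
      qed (use W in \<open>simp add: extensional_def\<close>)
    qed
  qed
qed

lemma card_piecewise_balanced:
  assumes N: "finite N" "\<Union>P = N" "disjoint P" and even: "\<And>c. c \<in> P \<Longrightarrow> even (card c)"
  shows "card (piecewise_balanced N P) = (\<Prod>c\<in>P. card c choose (card c div 2))"
proof -
  have fin: "finite P" "\<And>c. c \<in> P \<Longrightarrow> finite c"
    using N(1,2) by (auto intro: finite_UnionD finite_subset)
  have "card (piecewise_balanced N P)
      = card (PiE_dflt P (\<lambda>_. undefined) (balanced_assignments :: 'a set \<Rightarrow> _))"
    by (rule bij_betw_same_card[symmetric]) (rule glue_balanced_assignments_bij[OF N(2,3)])
  also have "\<dots> = (\<Prod>c\<in>P. card (balanced_assignments c))"
    using fin by (intro card_PiE_dflt finite_balanced_assignments)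
  also have "\<dots> = (\<Prod>c\<in>P. card c choose (card c div 2))"
    using fin(2) even by (intro prod.cong card_balanced_assignments) auto
  finally show ?thesis .
qed

lemma independent_randomization_eq:
  fixes N :: "nat set"
  assumes N: "finite N" "\<Union>P = N" "disjoint P" and even: "\<And>c. c \<in> P \<Longrightarrow> even (card c)"
  shows "map_pmf (\<lambda>V. \<lambda>i\<in>N. V (THE c. c \<in> P \<and> i \<in> c) i)
           (Pi_pmf P (\<lambda>_. undefined) complete_randomization)
         = pmf_of_set (piecewise_balanced N P)"
proof -
  have fin: "finite P" "\<And>c. c \<in> P \<Longrightarrow> finite c"
    using N(1,2) by (auto intro: finite_UnionD finite_subset)
  have finB: "finite (balanced_assignments c)" if "c \<in> P" for c
    using fin(2)[OF that] by (rule finite_balanced_assignments)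
  have ne: "balanced_assignments c \<noteq> {}" if "c \<in> P" for c
  proof -
    have "0 < card (balanced_assignments c)"
      unfolding card_balanced_assignments[OF fin(2)[OF that] even[OF that]] by simp
    then show ?thesis by auto
  qed
  let ?D = "PiE_dflt P (\<lambda>_. undefined) balanced_assignments"
  have "Pi_pmf P (\<lambda>_. undefined) complete_randomization
      = Pi_pmf P (\<lambda>_. undefined) (\<lambda>c. pmf_of_set (balanced_assignments c))"
    by (rule Pi_pmf_cong) (auto simp: complete_randomization_eq fin(2))
  also have "\<dots> = pmf_of_set ?D"
    using fin(1) finB ne by (rule Pi_pmf_of_set)
  also have "map_pmf (\<lambda>V. \<lambda>i\<in>N. V (THE c. c \<in> P \<and> i \<in> c) i) \<dots> = pmf_of_set (piecewise_balanced N P)"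
  proof (rule map_pmf_of_set_bij_betw[OF glue_balanced_assignments_bij[OF N(2,3)]])
    show "?D \<noteq> {}" using ne by simp
    show "finite ?D" using fin(1) finB by (rule finite_PiE_dflt)
  qed
  finally show ?thesis .
qed

section \<open>Fibres of the covariate map\<close>

definition fibre :: "'i set \<Rightarrow> ('i \<Rightarrow> 'x) \<Rightarrow> 'x \<Rightarrow> 'i set" where
  "fibre N X x = {i \<in> N. X i = x}"

lemma fibre_subset: "fibre N X x \<subseteq> N"
  unfolding fibre_def by auto

lemma finite_fibre: "finite N \<Longrightarrow> finite (fibre N X x)"
  using fibre_subset by (rule finite_subset)

lemma sum_over_fibres:
  fixes g :: "'i \<Rightarrow> 'b::comm_monoid_add"
  assumes "finite N" and "S \<subseteq> N"
  shows "sum g S = (\<Sum>x\<in>X ` N. sum g (S \<inter> fibre N X x))"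
proof -
  have "S \<inter> fibre N X x = {i \<in> S. X i = x}" for x
    using assms(2) unfolding fibre_def by auto
  then show ?thesis
    using assms by (simp add: sum.group[of S "X ` N" X g] finite_subset image_mono)
qed

text \<open>
  A set of subjects is the same as an independent choice of a subset of every fibre.  This turns both
  the existence of minimal left-over sets and the number of them that suit a given assignment into
  computations within single fibres.
\<close>

lemma card_fibrewise_selections:
  assumes "finite N" and "\<And>x. x \<in> X ` N \<Longrightarrow> C x \<subseteq> Pow (fibre N X x)"
  shows "card {L. L \<subseteq> N \<and> (\<forall>x\<in>X ` N. L \<inter> fibre N X x \<in> C x)} = (\<Prod>x\<in>X ` N. card (C x))"
proof -
  let ?S = "{L. L \<subseteq> N \<and> (\<forall>x\<in>X ` N. L \<inter> fibre N X x \<in> C x)}"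
  let ?join = "\<lambda>K. \<Union>x\<in>X ` N. K x"
  have join: "?join K \<inter> fibre N X x = K x" if K: "K \<in> Pi\<^sub>E (X ` N) C" and x: "x \<in> X ` N" for K x
  proof -
    have K': "K y \<subseteq> fibre N X y" if "y \<in> X ` N" for y
      using K assms(2)[OF that] that by auto
    show ?thesis
    proof (intro equalityI subsetI)
      fix i assume "i \<in> ?join K \<inter> fibre N X x"
      then obtain y where "y \<in> X ` N" "i \<in> K y" "X i = x" by (auto simp: fibre_def)
      moreover from this have "X i = y" using K'[of y] by (auto simp: fibre_def)
      ultimately show "i \<in> K x" by simp
    next
      fix i assume "i \<in> K x"
      then show "i \<in> ?join K \<inter> fibre N X x" using K'[OF x] x by blast
    qed
  qed
  have "bij_betw (\<lambda>L. \<lambda>x\<in>X ` N. L \<inter> fibre N X x) ?S (Pi\<^sub>E (X ` N) C)"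
  proof (rule bij_betwI[where g = ?join])
    show "(\<lambda>L. \<lambda>x\<in>X ` N. L \<inter> fibre N X x) \<in> ?S \<rightarrow> Pi\<^sub>E (X ` N) C" by auto
    show "?join \<in> Pi\<^sub>E (X ` N) C \<rightarrow> ?S"
    proof
      fix K assume K: "K \<in> Pi\<^sub>E (X ` N) C"
      have "K x \<subseteq> N" if "x \<in> X ` N" for x
        using K assms(2)[OF that] that fibre_subset[of N X x] by blast
      then have "?join K \<subseteq> N" by blast
      moreover have "?join K \<inter> fibre N X x \<in> C x" if "x \<in> X ` N" for x
        unfolding join[OF K that] using K that by blast
      ultimately show "?join K \<in> ?S" by blast
    qed
  next
    fix L assume "L \<in> ?S"
    then have "L \<subseteq> N" by blast
    then show "(\<Union>x\<in>X ` N. (\<lambda>x\<in>X ` N. L \<inter> fibre N X x) x) = L"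
      by (auto simp: fibre_def)
  next
    fix K assume K: "K \<in> Pi\<^sub>E (X ` N) C"
    show "(\<lambda>x\<in>X ` N. ?join K \<inter> fibre N X x) = K"
    proof
      fix x show "(\<lambda>x\<in>X ` N. ?join K \<inter> fibre N X x) x = K x"
        using K join[OF K, of x] by (cases "x \<in> X ` N") (auto simp: PiE_def extensional_def)
    qed
  qed
  then have "card ?S = card (Pi\<^sub>E (X ` N) C)" by (rule bij_betw_same_card)
  also have "\<dots> = (\<Prod>x\<in>X ` N. card (C x))" using assms(1) by (intro card_PiE) auto
  finally show ?thesis .
qed

section \<open>Blockings with fewest left-overs\<close>

definition minimal_leftovers :: "'i set \<Rightarrow> ('i \<Rightarrow> 'x) \<Rightarrow> 'i set set" where
  "minimal_leftovers N X =
     {L. L \<subseteq> N \<and> (\<forall>x\<in>X ` N. card (L \<inter> fibre N X x) = card (fibre N X x) mod 2)}"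

definition blocks_avoiding :: "'i set \<Rightarrow> ('i \<Rightarrow> 'x) \<Rightarrow> 'i set \<Rightarrow> 'i set set" where
  "blocks_avoiding N X L = (\<lambda>x. fibre N X x - L) ` X ` N - {{}}"

text \<open>
  There are \<open>m\<close> choose \<open>m mod 2\<close> ways to pick the left-overs in a fibre of size \<open>m\<close>, never none.
\<close>

lemma minimal_leftovers_ne:
  assumes "finite N"
  shows "minimal_leftovers N X \<noteq> {}"
proof -
  let ?C = "\<lambda>x. {K. K \<subseteq> fibre N X x \<and> card K = card (fibre N X x) mod 2}"
  have "minimal_leftovers N X = {L. L \<subseteq> N \<and> (\<forall>x\<in>X ` N. L \<inter> fibre N X x \<in> ?C x)}"
    unfolding minimal_leftovers_def by auto
  then have "card (minimal_leftovers N X) = (\<Prod>x\<in>X ` N. card (?C x))"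
    using card_fibrewise_selections[OF assms, of X ?C] by auto
  also have "\<dots> = (\<Prod>x\<in>X ` N. card (fibre N X x) choose (card (fibre N X x) mod 2))"
    by (simp add: n_subsets finite_fibre assms)
  also have "\<dots> \<noteq> 0" using assms by (simp add: not_less)
  finally show ?thesis by auto
qed

lemma finite_minimal_leftovers: "finite N \<Longrightarrow> finite (minimal_leftovers N X)"
  by (rule finite_subset[of _ "Pow N"]) (auto simp: minimal_leftovers_def)

lemma card_fibre_split:
  assumes "finite N"
  shows "card (fibre N X x) = card (fibre N X x - L) + card (L \<inter> fibre N X x)"
  using card_Int_Diff[OF finite_fibre[OF assms], of X x L] by (simp add: Int_commute)

lemma minimal_leftovers_block_card:
  assumes "finite N" "L \<in> minimal_leftovers N X" "x \<in> X ` N"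
  shows "card (fibre N X x - L) = card (fibre N X x) - card (fibre N X x) mod 2"
    and "even (card (fibre N X x - L))"
proof -
  have "card (L \<inter> fibre N X x) = card (fibre N X x) mod 2"
    using assms(2,3) unfolding minimal_leftovers_def by blast
  then show eq: "card (fibre N X x - L) = card (fibre N X x) - card (fibre N X x) mod 2"
    using card_fibre_split[OF assms(1), of X x L] by linarith
  show "even (card (fibre N X x - L))"
    unfolding eq by (simp add: minus_mod_eq_mult_div)
qed

lemma card_eq_sum_fibres:
  assumes "finite N" "L \<subseteq> N"
  shows "card L = (\<Sum>x\<in>X ` N. card (L \<inter> fibre N X x))"
  using sum_over_fibres[OF assms, of "\<lambda>_. 1::nat" X] by simp

lemma parity_le_card_leftovers:
  assumes "finite N" "even (card (fibre N X x - L))"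
  shows "card (fibre N X x) mod 2 \<le> card (L \<inter> fibre N X x)"
proof -
  have "card (fibre N X x) mod 2 = card (L \<inter> fibre N X x) mod 2"
    using assms(2) unfolding card_fibre_split[OF assms(1), of X x L] by (auto elim!: evenE)
  then show ?thesis by simp
qed

text \<open>
  Deleting \<open>L\<close> makes every fibre even only if \<open>L\<close> meets the fibre in a number of subjects of the same
  parity as its size, so at least in one subject if the fibre is odd.  The lower bound on the size of
  \<open>L\<close> is the sum of these bounds and is attained iff each of them is.
\<close>

lemma card_leftovers_minimal_iff:
  assumes "finite N" "L \<subseteq> N" "\<forall>x\<in>X ` N. even (card (fibre N X x - L))"
  shows "(\<Sum>x\<in>X ` N. card (fibre N X x) mod 2) \<le> card L"
    and "card L = (\<Sum>x\<in>X ` N. card (fibre N X x) mod 2) \<longleftrightarrow> L \<in> minimal_leftovers N X"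
proof -
  have le: "card (fibre N X x) mod 2 \<le> card (L \<inter> fibre N X x)" if "x \<in> X ` N" for x
    using assms(3) that by (intro parity_le_card_leftovers[OF assms(1)]) blast
  show "(\<Sum>x\<in>X ` N. card (fibre N X x) mod 2) \<le> card L"
    unfolding card_eq_sum_fibres[OF assms(1,2), of X] by (rule sum_mono) (rule le)
  show "card L = (\<Sum>x\<in>X ` N. card (fibre N X x) mod 2) \<longleftrightarrow> L \<in> minimal_leftovers N X"
    unfolding card_eq_sum_fibres[OF assms(1,2), of X]
    using sum_eq_sum_lower_bounds_iff[of "X ` N" "\<lambda>x. card (fibre N X x) mod 2"
        "\<lambda>x. card (L \<inter> fibre N X x)"] le assms(1,2)
    unfolding minimal_leftovers_def by blast
qed

lemma blocks_avoiding_partition: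
  assumes "L \<subseteq> N"
  shows "partition_on (N - L) (blocks_avoiding N X L)"
  unfolding partition_on_def
proof (intro conjI)
  show "\<Union> (blocks_avoiding N X L) = N - L"
    unfolding blocks_avoiding_def fibre_def by auto
  show "disjoint (blocks_avoiding N X L)"
    unfolding blocks_avoiding_def fibre_def disjoint_def by auto
qed (simp add: blocks_avoiding_def)

text \<open>
  Subjects in a block share their covariate and subjects in different blocks do not, so the blocks
  must be the nonempty rests of the fibres after deletion of the left-overs.
\<close>

lemma is_blocking_iff:
  "is_blocking n X (Bs, L) \<longleftrightarrow> L \<subseteq> {1..n} \<and> Bs = blocks_avoiding {1..n} X L \<and>
     (\<forall>x\<in>X ` {1..n}. even (card (fibre {1..n} X x - L)))" (is "_ \<longleftrightarrow> ?R")
proof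
  assume "is_blocking n X (Bs, L)"
  note B = this[unfolded is_blocking_def prod.case partition_on_def]
  note L = B[THEN conjunct1]
    and part = B[THEN conjunct2, THEN conjunct1]
    and cond = B[THEN conjunct2, THEN conjunct2]
  note U = part[THEN conjunct1] and ne = part[THEN conjunct2, THEN conjunct2]
    and even = cond[THEN conjunct1] and same = cond[THEN conjunct2, THEN conjunct1]
    and diff = cond[THEN conjunct2, THEN conjunct2]
  have block: "b = fibre {1..n} X (X i) - L" if b: "b \<in> Bs" "i \<in> b" for b i
  proof (intro equalityI subsetI)
    fix j assume j: "j \<in> b"
    then have "j \<in> \<Union>Bs" using b(1) by blast
    then have "j \<in> {1..n} - L" unfolding U .
    moreover have "X j = X i" using same b j by blast
    ultimately show "j \<in> fibre {1..n} X (X i) - L" by (simp add: fibre_def)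
  next
    fix j assume j: "j \<in> fibre {1..n} X (X i) - L"
    then have "j \<in> \<Union>Bs" unfolding U by (simp add: fibre_def)
    then obtain c where c: "c \<in> Bs" "j \<in> c" by blast
    moreover have "X i = X j" using j by (simp add: fibre_def)
    ultimately have "b = c" using diff b by blast
    with c show "j \<in> b" by simp
  qed
  have mem: "fibre {1..n} X x - L \<in> Bs" if nonempty: "fibre {1..n} X x - L \<noteq> {}" for x
  proof -
    obtain i where i: "i \<in> fibre {1..n} X x - L" using nonempty by blast
    then have "i \<in> \<Union>Bs" unfolding U by (simp add: fibre_def)
    then obtain b where b: "b \<in> Bs" "i \<in> b" by blast
    moreover have "X i = x" using i by (simp add: fibre_def)
    ultimately show ?thesis using block[OF b] by simp
  qed
  have "Bs = blocks_avoiding {1..n} X L"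
  proof (intro equalityI subsetI)
    fix b assume b: "b \<in> Bs"
    then obtain i where i: "i \<in> b" using ne by (metis all_not_in_conv)
    then have "i \<in> \<Union>Bs" using b by blast
    then have "i \<in> {1..n}" unfolding U by blast
    with block[OF b i] i show "b \<in> blocks_avoiding {1..n} X L"
      unfolding blocks_avoiding_def by blast
  next
    fix b assume "b \<in> blocks_avoiding {1..n} X L"
    then show "b \<in> Bs" using mem unfolding blocks_avoiding_def by blast
  qed
  moreover have "even (card (fibre {1..n} X x - L))" for x
  proof (cases "fibre {1..n} X x - L = {}")
    case False
    show ?thesis using even mem[OF False] by blast
  next
    case True
    show ?thesis unfolding True by simp
  qed
  ultimately show ?R using L by blast
next
  assume R: ?R
  then have Bs: "Bs = blocks_avoiding {1..n} X L" and L: "L \<subseteq> {1..n}" by blast+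
  have block: "\<exists>x\<in>X ` {1..n}. b = fibre {1..n} X x - L" if "b \<in> Bs" for b
    using that unfolding Bs blocks_avoiding_def by blast
  show "is_blocking n X (Bs, L)"
    unfolding is_blocking_def prod.case
  proof (intro conjI ballI impI)
    show "L \<subseteq> {1..n}" by (rule L)
    show "partition_on ({1..n} - L) Bs" unfolding Bs using L by (rule blocks_avoiding_partition)
    fix b assume b: "b \<in> Bs"
    then obtain x where x: "x \<in> X ` {1..n}" "b = fibre {1..n} X x - L" using block by blast
    with R show "even (card b)" by blast
    show "X i = X j" if "i \<in> b" "j \<in> b" for i j using that x by (simp add: fibre_def)
    fix c i j assume c: "c \<in> Bs" "b \<noteq> c" "i \<in> b" "j \<in> c"
    then obtain y where "c = fibre {1..n} X y - L" using block by blast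
    with c x show "X i \<noteq> X j" by (auto simp: fibre_def)
  qed
qed

lemma minimal_blockings_eq:
  "{BL. is_arg_min (\<lambda>(Bs, L). card L) (is_blocking n X) BL}
   = (\<lambda>L. (blocks_avoiding {1..n} X L, L)) ` minimal_leftovers {1..n} X"
proof -
  let ?N = "{1..n}"
  let ?c = "\<Sum>x\<in>X ` ?N. card (fibre ?N X x) mod 2"
  obtain L0 where L0: "L0 \<in> minimal_leftovers ?N X"
    using minimal_leftovers_ne[of ?N X] by auto
  have blk: "is_blocking n X (blocks_avoiding ?N X L, L)" if "L \<in> minimal_leftovers ?N X" for L
    unfolding is_blocking_iff using that minimal_leftovers_block_card(2)[OF _ that]
    by (auto simp: minimal_leftovers_def)
  have card: "?c \<le> card L" "card L = ?c \<longleftrightarrow> L \<in> minimal_leftovers ?N X"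
    if "is_blocking n X (Bs, L)" for Bs L
    using card_leftovers_minimal_iff[of ?N L X] that unfolding is_blocking_iff by auto
  have bs: "Bs = blocks_avoiding ?N X L" if "is_blocking n X (Bs, L)" for Bs L
    using that unfolding is_blocking_iff by blast
  have "is_arg_min (\<lambda>(Bs, L). card L) (is_blocking n X) BL
      \<longleftrightarrow> is_blocking n X BL \<and> (\<lambda>(Bs, L). card L) BL = ?c" for BL
  proof (rule is_arg_min_iff_eq_lower_bound)
    show "?c \<le> (\<lambda>(Bs, L). card L) BL" if "is_blocking n X BL" for BL
      using that card(1) by (cases BL) auto
    show "(\<lambda>(Bs, L). card L) (blocks_avoiding ?N X L0, L0) = ?c"
      using card(2)[OF blk[OF L0]] L0 by simp
  qed (rule blk[OF L0])
  then have "is_arg_min (\<lambda>(Bs, L). card L) (is_blocking n X) (Bs, L)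
      \<longleftrightarrow> Bs = blocks_avoiding ?N X L \<and> L \<in> minimal_leftovers ?N X" for Bs L
    using card(2)[of Bs L] blk[of L] bs[of Bs L] by auto
  then show ?thesis by auto
qed

section \<open>Assignments that split every fibre as evenly as possible\<close>

definition fibrewise_balanced :: "'i set \<Rightarrow> ('i \<Rightarrow> 'x) \<Rightarrow> ('i \<Rightarrow> nat) set" where
  "fibrewise_balanced N X = {W \<in> balanced_assignments N.
     \<forall>x\<in>X ` N. \<bar>treatment_sum W (fibre N X x)\<bar> = real (card (fibre N X x) mod 2)}"

text \<open>
  The sets that incomplete blocking randomizes separately when the left-over set is \<open>L\<close>.
\<close>

abbreviation leftover_pieces :: "'i set \<Rightarrow> ('i \<Rightarrow> 'x) \<Rightarrow> 'i set \<Rightarrow> 'i set set" where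
  "leftover_pieces N X L \<equiv> insert L (blocks_avoiding N X L)"

lemma treatment_sum_split:
  assumes "finite S"
  shows "treatment_sum W S = treatment_sum W (S - L) + treatment_sum W (L \<inter> S)"
  using sum.Int_Diff[OF assms, of "\<lambda>i. treatment_sign (W i)" L]
  by (simp add: treatment_sum_def Int_commute add.commute)

lemma leftover_pieces_partition:
  assumes "L \<subseteq> N"
  shows "\<Union>(leftover_pieces N X L) = N" and "disjoint (leftover_pieces N X L)"
proof -
  have part: "\<Union>(blocks_avoiding N X L) = N - L" "disjoint (blocks_avoiding N X L)"
    using blocks_avoiding_partition[OF assms, of X] unfolding partition_on_def by blast+
  show "\<Union>(leftover_pieces N X L) = N" using part(1) assms by blast
  have "c \<inter> L = {}" if "c \<in> blocks_avoiding N X L" for c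
    using that unfolding blocks_avoiding_def by blast
  then show "disjoint (leftover_pieces N X L)"
    using part(2) by (simp add: pairwise_insert disjnt_def Int_commute)
qed

text \<open>
  The left-over set has even size because the total and all blocks have even size; this is what makes
  complete randomization of the left-overs possible.
\<close>

lemma even_card_leftover_pieces:
  assumes "finite N" "even (card N)" "L \<in> minimal_leftovers N X" "c \<in> leftover_pieces N X L"
  shows "even (card c)"
proof -
  have L: "L \<subseteq> N" using assms(3) by (simp add: minimal_leftovers_def)
  have "card N = (\<Sum>x\<in>X ` N. card (fibre N X x))"
    using card_eq_sum_fibres[OF assms(1) subset_refl, of X] fibre_subset[of N X]
    by (simp add: Int_absorb1)
  also have "\<dots> = (\<Sum>x\<in>X ` N. card (fibre N X x - L)) + card L"
    unfolding card_eq_sum_fibres[OF assms(1) L, of X]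
    by (simp add: card_fibre_split[OF assms(1), of X _ L] sum.distrib)
  finally have "even (card L)"
    using assms(2) minimal_leftovers_block_card(2)[OF assms(1,3)] by (simp add: dvd_sum)
  then show ?thesis
    using assms(4) minimal_leftovers_block_card(2)[OF assms(1,3)]
    by (auto simp: blocks_avoiding_def)
qed

text \<open>
  Once all blocks are balanced, the treatment sum over the left-overs is that over all subjects, so
  balance of the left-over set can be exchanged for overall balance.  The latter does not involve \<open>L\<close>,
  and the remaining condition concerns each fibre separately.
\<close>

lemma piecewise_balanced_leftover_iff:
  assumes "finite N" "L \<subseteq> N"
  shows "W \<in> piecewise_balanced N (leftover_pieces N X L) \<longleftrightarrow>
    W \<in> balanced_assignments N \<and> (\<forall>x\<in>X ` N. treatment_sum W (fibre N X x - L) = 0)"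
proof -
  have blocks: "(\<forall>c\<in>blocks_avoiding N X L. treatment_sum W c = 0)
      \<longleftrightarrow> (\<forall>x\<in>X ` N. treatment_sum W (fibre N X x - L) = 0)"
    unfolding blocks_avoiding_def by (auto simp: treatment_sum_def)
  have "treatment_sum W N = treatment_sum W L"
    if "\<forall>x\<in>X ` N. treatment_sum W (fibre N X x - L) = 0"
  proof -
    have "treatment_sum W (N - L) = (\<Sum>x\<in>X ` N. treatment_sum W ((N - L) \<inter> fibre N X x))"
      unfolding treatment_sum_def by (rule sum_over_fibres[OF assms(1)]) auto
    also have "\<dots> = 0"
    proof (rule sum.neutral, rule ballI)
      fix x assume "x \<in> X ` N"
      then have "treatment_sum W (fibre N X x - L) = 0" using that by blast
      moreover have "(N - L) \<inter> fibre N X x = fibre N X x - L" by (auto simp: fibre_def)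
      ultimately show "treatment_sum W ((N - L) \<inter> fibre N X x) = 0" by simp
    qed
    finally show ?thesis
      using treatment_sum_split[OF assms(1), of W L] assms(2) by (simp add: Int_absorb2)
  qed
  with blocks show ?thesis
    unfolding piecewise_balanced_def balanced_assignments_def by auto
qed

lemma abs_treatment_sum_eq_card_if_le_1:
  assumes "finite K" and "card K \<le> 1"
  shows "\<bar>treatment_sum W K\<bar> = real (card K)"
proof -
  from assms consider "K = {}" | i where "K = {i}"
    by (metis card_1_singletonE card_eq_0_iff le_less less_one)
  then show ?thesis by cases (auto simp: treatment_sum_def treatment_sign_def)
qed

text \<open>
  The blocks contribute nothing to the treatment sum of a fibre, which is therefore that of the at
  most one left-over subject in the fibre.
\<close>

lemma piecewise_balanced_subset_fibrewise_balanced: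
  assumes "finite N" "L \<in> minimal_leftovers N X"
  shows "piecewise_balanced N (leftover_pieces N X L) \<subseteq> fibrewise_balanced N X"
proof
  fix W assume W: "W \<in> piecewise_balanced N (leftover_pieces N X L)"
  have L: "L \<subseteq> N" using assms(2) by (simp add: minimal_leftovers_def)
  note W' = W[unfolded piecewise_balanced_leftover_iff[OF assms(1) L]]
  have "\<bar>treatment_sum W (fibre N X x)\<bar> = real (card (fibre N X x) mod 2)" if x: "x \<in> X ` N" for x
  proof -
    have c: "card (L \<inter> fibre N X x) = card (fibre N X x) mod 2"
      using assms(2) x unfolding minimal_leftovers_def by blast
    have "treatment_sum W (fibre N X x) = treatment_sum W (L \<inter> fibre N X x)"
      using treatment_sum_split[OF finite_fibre[OF assms(1)], of W X x L] W' x by simp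
    also have "\<bar>\<dots>\<bar> = real (card (L \<inter> fibre N X x))"
      using c finite_fibre[OF assms(1), of X x] by (intro abs_treatment_sum_eq_card_if_le_1) auto
    finally show ?thesis using c by simp
  qed
  with W' show "W \<in> fibrewise_balanced N X" by (simp add: fibrewise_balanced_def)
qed

text \<open>
  The right-hand side does not mention \<open>L\<close>: all minimal left-over sets admit equally many assignments.
\<close>

lemma card_piecewise_balanced_leftover:
  assumes "finite N" "even (card N)" "L \<in> minimal_leftovers N X"
  defines "h \<equiv> \<lambda>m::nat. m choose (m div 2)"
  shows "card (piecewise_balanced N (leftover_pieces N X L)) =
    h (\<Sum>x\<in>X ` N. card (fibre N X x) mod 2) *
    (\<Prod>x\<in>X ` N. h (card (fibre N X x) - card (fibre N X x) mod 2))"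
proof -
  let ?B = "blocks_avoiding N X L"
  have L: "L \<subseteq> N" using assms(3) by (simp add: minimal_leftovers_def)
  have finB: "finite ?B" using assms(1) by (simp add: blocks_avoiding_def)
  have LB: "L \<notin> ?B" by (auto simp: blocks_avoiding_def)
  have cardL: "card L = (\<Sum>x\<in>X ` N. card (fibre N X x) mod 2)"
    using assms(3) minimal_leftovers_block_card(2)[OF assms(1,3)]
    by (subst card_leftovers_minimal_iff(2)[OF assms(1) L]) blast+
  have "card (piecewise_balanced N (leftover_pieces N X L)) = (\<Prod>c\<in>insert L ?B. h (card c))"
    unfolding h_def
    using leftover_pieces_partition[OF L] even_card_leftover_pieces[OF assms(1-3)]
    by (intro card_piecewise_balanced assms(1))
  also have "\<dots> = h (card L) * (\<Prod>c\<in>?B. h (card c))" using finB LB by simp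
  \<comment> \<open>Fibres that are used up by the left-overs give no block; as \<open>h 0 = 1\<close>, they may be included in the product.\<close>
  also have "(\<Prod>c\<in>?B. h (card c)) = (\<Prod>c\<in>(\<lambda>x. fibre N X x - L) ` X ` N. h (card c))"
    unfolding blocks_avoiding_def using assms(1)
    by (intro prod.mono_neutral_left) (auto simp: h_def)
  also have "\<dots> = (\<Prod>x\<in>X ` N. h (card (fibre N X x - L)))"
  proof (subst prod.reindex_nontrivial)
    \<comment> \<open>Distinct covariates give the same set only if it is empty, which has the factor 1.\<close>
    fix x y assume "x \<noteq> y" "fibre N X x - L = fibre N X y - L"
    then have empty: "fibre N X x - L = {}" by (auto simp: fibre_def)
    show "h (card (fibre N X x - L)) = 1" unfolding empty by (simp add: h_def)
  qed (use assms(1) in auto)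
  also have "\<dots> = (\<Prod>x\<in>X ` N. h (card (fibre N X x) - card (fibre N X x) mod 2))"
    using minimal_leftovers_block_card(1)[OF assms(1,3)] by simp
  finally show ?thesis unfolding cardL .
qed

text \<open>
  In an odd fibre, removing a subject leaves a balanced rest iff the sign of the subject is the
  treatment sum of the fibre.  That sum is 1 or -1, so these are the subjects of the majority
  treatment, and a majority by one has \<open>(card F + 1) div 2\<close> members.
\<close>

lemma card_leftover_choices_in_fibre:
  assumes "finite F" "W \<in> F \<rightarrow> {1, 2}" "\<bar>treatment_sum W F\<bar> = real (card F mod 2)"
  shows "card {K. K \<subseteq> F \<and> card K = card F mod 2 \<and> treatment_sum W (F - K) = 0}
    = (if even (card F) then 1 else (card F + 1) div 2)"
proof (cases "even (card F)")
  case True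
  then have "{K. K \<subseteq> F \<and> card K = card F mod 2 \<and> treatment_sum W (F - K) = 0} = {{}}"
    using assms finite_subset by fastforce
  with True show ?thesis by simp
next
  case False
  let ?M = "{i \<in> F. treatment_sign (W i) = treatment_sum W F}"
  have odd: "card F mod 2 = 1" using False by (simp add: mod_2_eq_odd)
  have split: "treatment_sum W F = treatment_sum W (F - {i}) + treatment_sign (W i)" if "i \<in> F" for i
    using treatment_sum_split[OF assms(1), of W "{i}"] that by (simp add: treatment_sum_def)
  have "{K. K \<subseteq> F \<and> card K = card F mod 2 \<and> treatment_sum W (F - K) = 0} = (\<lambda>i. {i}) ` ?M"
    unfolding odd using split by (auto simp: card_1_singleton_iff)
  then have "card {K. K \<subseteq> F \<and> card K = card F mod 2 \<and> treatment_sum W (F - K) = 0} = card ?M"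
    by (simp add: card_image)
  also have "card ?M = (card F + 1) div 2"
  proof -
    note counts = treatment_counts[OF assms(1,2)]
    consider "treatment_sum W F = 1" | "treatment_sum W F = - 1"
      using assms(3) odd by fastforce
    then show ?thesis
    proof cases
      case 1
      have "?M = {i \<in> F. W i = 1}" using assms(2) unfolding 1 by (auto simp: treatment_sign_def)
      then have "card ?M = card {i \<in> F. W i = 1}" by (rule arg_cong)
      moreover have "card {i \<in> F. W i = 1} = card {i \<in> F. W i = 2} + 1" using 1 counts(2) by linarith
      ultimately show ?thesis using counts(1) by linarith
    next
      case 2
      have "?M = {i \<in> F. W i = 2}" using assms(2) unfolding 2 by (auto simp: treatment_sign_def)
      then have "card ?M = card {i \<in> F. W i = 2}" by (rule arg_cong)
      moreover have "card {i \<in> F. W i = 2} = card {i \<in> F. W i = 1} + 1" using 2 counts(2) by linarith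
      ultimately show ?thesis using counts(1) by linarith
    qed
  qed
  finally show ?thesis using False by simp
qed

text \<open>
  The right-hand side does not mention \<open>W\<close>, which is why no fibrewise balanced assignment is favoured.
\<close>

lemma card_compatible_leftovers:
  assumes "finite N" "W \<in> fibrewise_balanced N X"
  shows "card {L \<in> minimal_leftovers N X. W \<in> piecewise_balanced N (leftover_pieces N X L)}
    = (\<Prod>x\<in>X ` N. if even (card (fibre N X x)) then 1 else (card (fibre N X x) + 1) div 2)"
proof -
  let ?F = "fibre N X"
  let ?C = "\<lambda>x. {K. K \<subseteq> ?F x \<and> card K = card (?F x) mod 2 \<and> treatment_sum W (?F x - K) = 0}"
  have bal: "W \<in> balanced_assignments N" using assms(2) by (simp add: fibrewise_balanced_def)
  have "?F x - L \<inter> ?F x = ?F x - L" for x L by auto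
  then have "{L \<in> minimal_leftovers N X. W \<in> piecewise_balanced N (leftover_pieces N X L)}
      = {L. L \<subseteq> N \<and> (\<forall>x\<in>X ` N. L \<inter> ?F x \<in> ?C x)}"
    unfolding minimal_leftovers_def
    using piecewise_balanced_leftover_iff[OF assms(1), of _ W X] bal by auto
  then have "card {L \<in> minimal_leftovers N X. W \<in> piecewise_balanced N (leftover_pieces N X L)}
      = (\<Prod>x\<in>X ` N. card (?C x))"
    using card_fibrewise_selections[OF assms(1), of X ?C] by auto
  also have "\<dots> = (\<Prod>x\<in>X ` N. if even (card (?F x)) then 1 else (card (?F x) + 1) div 2)"
  proof (rule prod.cong[OF refl])
    fix x assume "x \<in> X ` N"
    moreover have "W \<in> ?F x \<rightarrow> {1, 2}"
      using bal fibre_subset[of N X x] by (auto simp: balanced_assignments_def)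
    ultimately show "card (?C x) = (if even (card (?F x)) then 1 else (card (?F x) + 1) div 2)"
      using assms by (intro card_leftover_choices_in_fibre finite_fibre)
        (auto simp: fibrewise_balanced_def)
  qed
  finally show ?thesis .
qed

section \<open>Both designs are uniform on these assignments\<close>

lemma incomplete_blocking_eq_bind:
  assumes "even n"
  shows "incomplete_blocking n X = bind_pmf (pmf_of_set (minimal_leftovers {1..n} X))
    (\<lambda>L. pmf_of_set (piecewise_balanced {1..n} (leftover_pieces {1..n} X L)))"
proof -
  let ?N = "{1..n}"
  let ?Ls = "minimal_leftovers ?N X"
  have Ls: "?Ls \<noteq> {}" "finite ?Ls"
    using minimal_leftovers_ne finite_minimal_leftovers by auto
  have "pmf_of_set ((\<lambda>L. (blocks_avoiding ?N X L, L)) ` ?Ls)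
      = map_pmf (\<lambda>L. (blocks_avoiding ?N X L, L)) (pmf_of_set ?Ls)"
    using Ls by (intro map_pmf_of_set_inj[symmetric]) (auto simp: inj_on_def)
  then have "incomplete_blocking n X = bind_pmf (pmf_of_set ?Ls) (\<lambda>L.
      map_pmf (\<lambda>V. \<lambda>i\<in>?N. V (THE c. c \<in> leftover_pieces ?N X L \<and> i \<in> c) i)
        (Pi_pmf (leftover_pieces ?N X L) (\<lambda>_. undefined) complete_randomization))"
    unfolding incomplete_blocking_def minimal_blockings_eq by (simp only: bind_map_pmf prod.case)
  also have "\<dots> = bind_pmf (pmf_of_set ?Ls)
      (\<lambda>L. pmf_of_set (piecewise_balanced ?N (leftover_pieces ?N X L)))"
  proof (rule bind_pmf_cong[OF refl], rule independent_randomization_eq)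
    fix L assume "L \<in> set_pmf (pmf_of_set ?Ls)"
    then have L: "L \<in> ?Ls" using Ls by simp
    then have "L \<subseteq> ?N" unfolding minimal_leftovers_def by blast
    then show "\<Union>(leftover_pieces ?N X L) = ?N" "disjoint (leftover_pieces ?N X L)"
      by (rule leftover_pieces_partition)+
    show "even (card c)" if "c \<in> leftover_pieces ?N X L" for c
      using assms by (intro even_card_leftover_pieces[OF _ _ L that]) simp_all
  qed simp
  finally show ?thesis .
qed

lemma piecewise_balanced_leftover_ne:
  assumes "finite N" "even (card N)" "L \<in> minimal_leftovers N X"
  shows "piecewise_balanced N (leftover_pieces N X L) \<noteq> {}"
proof -
  have "card (piecewise_balanced N (leftover_pieces N X L)) \<noteq> 0"
    unfolding card_piecewise_balanced_leftover[OF assms] using assms(1) by (simp add: not_less)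
  then show ?thesis by auto
qed

lemma finite_fibrewise_balanced: "finite N \<Longrightarrow> finite (fibrewise_balanced N X)"
  by (rule finite_subset[OF _ finite_balanced_assignments]) (auto simp: fibrewise_balanced_def)

lemma fibrewise_balanced_ne:
  assumes "finite N" "even (card N)"
  shows "fibrewise_balanced N X \<noteq> {}"
proof -
  obtain L where L: "L \<in> minimal_leftovers N X" using minimal_leftovers_ne[OF assms(1)] by blast
  show ?thesis
    using piecewise_balanced_leftover_ne[OF assms L]
      piecewise_balanced_subset_fibrewise_balanced[OF assms(1) L] by blast
qed

text \<open>
  The probability of \<open>W\<close> is the number of left-over sets that suit \<open>W\<close>, divided by the number of all
  minimal left-over sets and by the number of assignments that each of them admits.
\<close>

lemma incomplete_blocking_uniform:
  assumes "even n"
  shows "incomplete_blocking n X = pmf_of_set (fibrewise_balanced {1..n} X)"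
proof -
  let ?N = "{1..n}"
  let ?Ls = "minimal_leftovers ?N X"
  let ?G = "\<lambda>L. piecewise_balanced ?N (leftover_pieces ?N X L)"
  have Ls: "?Ls \<noteq> {}" "finite ?Ls"
    using minimal_leftovers_ne finite_minimal_leftovers by auto
  have G: "?G L \<noteq> {}" "?G L \<subseteq> fibrewise_balanced ?N X" "finite (?G L)" if "L \<in> ?Ls" for L
    using piecewise_balanced_leftover_ne[OF _ _ that] assms
      piecewise_balanced_subset_fibrewise_balanced[OF _ that]
      finite_subset[OF _ finite_fibrewise_balanced[of ?N X]] by auto
  obtain g where g: "\<And>L. L \<in> ?Ls \<Longrightarrow> card (?G L) = g"
    using card_piecewise_balanced_leftover[of ?N _ X] assms by auto
  let ?q = "\<Prod>x\<in>X ` ?N. if even (card (fibre ?N X x)) then 1 else (card (fibre ?N X x) + 1) div 2"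
  show ?thesis
  proof (rule pmf_constant_imp_pmf_of_set)
    show "set_pmf (incomplete_blocking n X) \<subseteq> fibrewise_balanced ?N X"
      unfolding incomplete_blocking_eq_bind[OF assms] using Ls G by auto
    fix W assume W: "W \<in> fibrewise_balanced ?N X"
    have "pmf (pmf_of_set (?G L)) W = of_bool (W \<in> ?G L) / real g" if "L \<in> ?Ls" for L
      using G[OF that] g[OF that] by (simp add: indicator_def)
    then have "(\<Sum>L\<in>?Ls. pmf (pmf_of_set (?G L)) W) = (\<Sum>L\<in>?Ls. of_bool (W \<in> ?G L)) / real g"
      by (simp add: sum_divide_distrib)
    also have "(\<Sum>L\<in>?Ls. of_bool (W \<in> ?G L)) = real (card {L \<in> ?Ls. W \<in> ?G L})"
      using Ls(2) by (simp add: of_bool_def sum.If_cases Int_def)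
    also have "card {L \<in> ?Ls. W \<in> ?G L} = ?q"
      using W by (intro card_compatible_leftovers) auto
    finally show "pmf (incomplete_blocking n X) W = real ?q / real g / real (card ?Ls)"
      unfolding incomplete_blocking_eq_bind[OF assms] pmf_bind_pmf_of_set[OF Ls] by simp
  qed (simp add: finite_fibrewise_balanced)
qed

text \<open>
  This is the duality between the supremum norm and the 1-norm, applied to the vector of treatment
  sums of the fibres.
\<close>

lemma worst_imbalance_sq_sup_magnitude:
  "worst_imbalance_sq n X sup_magnitude W
   = ereal ((2 / real n * (\<Sum>x\<in>X ` {1..n}. \<bar>treatment_sum W (fibre {1..n} X x)\<bar>))\<^sup>2)"
proof -
  let ?N = "{1..n}"
  let ?s = "\<lambda>x. treatment_sum W (fibre ?N X x)"
  have eq: "(\<Sum>i=1..n. treatment_sign (W i) * f (X i)) = (\<Sum>x\<in>X ` ?N. ?s x * f x)" for f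
  proof -
    have "(\<Sum>i=1..n. treatment_sign (W i) * f (X i))
        = (\<Sum>x\<in>X ` ?N. \<Sum>i\<in>?N \<inter> fibre ?N X x. treatment_sign (W i) * f (X i))"
      by (rule sum_over_fibres) auto
    also have "\<dots> = (\<Sum>x\<in>X ` ?N. ?s x * f x)"
    proof (rule sum.cong[OF refl])
      fix x
      have "(\<Sum>i\<in>?N \<inter> fibre ?N X x. treatment_sign (W i) * f (X i))
          = (\<Sum>i\<in>fibre ?N X x. treatment_sign (W i) * f x)"
        by (rule sum.cong) (auto simp: fibre_def)
      then show "(\<Sum>i\<in>?N \<inter> fibre ?N X x. treatment_sign (W i) * f (X i)) = ?s x * f x"
        by (simp add: treatment_sum_def sum_distrib_right)
    qed
    finally show ?thesis .
  qed
  let ?m = "2 / real n * (\<Sum>x\<in>X ` ?N. \<bar>?s x\<bar>)"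
  have "(imbalance n X W f)\<^sup>2 \<le> ?m\<^sup>2" if f: "sup_magnitude f \<le> 1" for f
  proof -
    have "\<bar>\<Sum>x\<in>X ` ?N. ?s x * f x\<bar> \<le> (\<Sum>x\<in>X ` ?N. \<bar>?s x * f x\<bar>)" by (rule sum_abs)
    also have "\<dots> \<le> (\<Sum>x\<in>X ` ?N. \<bar>?s x\<bar>)"
      using f by (intro sum_mono) (simp add: abs_mult sup_magnitude_le_1_iff mult_left_le)
    finally have "\<bar>imbalance n X W f\<bar> \<le> ?m"
      unfolding imbalance_def eq abs_mult by (intro mult_mono) auto
    then show ?thesis using abs_le_square_iff by fastforce
  qed
  moreover have "sup_magnitude (\<lambda>x. sgn (?s x)) \<le> 1"
    by (auto simp: sup_magnitude_le_1_iff sgn_real_def)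
  moreover have "imbalance n X W (\<lambda>x. sgn (?s x)) = ?m"
    unfolding imbalance_def eq[of "\<lambda>x. sgn (?s x)"] by (simp add: abs_sgn)
  ultimately show ?thesis
    unfolding worst_imbalance_sq_def
    by (intro antisym SUP_least) (auto intro!: SUP_upper2[of "\<lambda>x. sgn (?s x)"])
qed

text \<open>
  The lower bounds on the individual fibres are attained simultaneously by any fibrewise balanced
  assignment, and such an assignment exists because incomplete blocking can produce one.
\<close>

lemma psod_sup_magnitude_uniform:
  assumes "p \<ge> 1"
  shows "psod p X sup_magnitude = pmf_of_set (fibrewise_balanced {1..2*p} X)"
proof -
  let ?N = "{1..2*p}"
  let ?total = "\<lambda>W. \<Sum>x\<in>X ` ?N. \<bar>treatment_sum W (fibre ?N X x)\<bar>"
  let ?k = "\<Sum>x\<in>X ` ?N. real (card (fibre ?N X x) mod 2)"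
  have le: "real (card (fibre ?N X x) mod 2) \<le> \<bar>treatment_sum W (fibre ?N X x)\<bar>"
    if "W \<in> assignments p" for W x
    using that fibre_subset[of ?N X x] unfolding assignments_eq balanced_assignments_def
    by (intro treatment_sum_ge_parity finite_fibre) auto
  have eq: "?total W = ?k \<longleftrightarrow> W \<in> fibrewise_balanced ?N X" if "W \<in> assignments p" for W
    using that le[OF that]
    by (subst sum_eq_sum_lower_bounds_iff) (auto simp: fibrewise_balanced_def assignments_eq)
  have square_eq: "(2 / real (2*p) * a)\<^sup>2 = (2 / real (2*p) * b)\<^sup>2 \<longleftrightarrow> a = b"
    if "0 \<le> a" "0 \<le> b" for a b
    using that assms by (subst power2_eq_iff_nonneg) auto
  obtain W0 where W0: "W0 \<in> fibrewise_balanced ?N X"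
    using fibrewise_balanced_ne[of ?N X] by auto
  then have W0': "W0 \<in> assignments p" by (simp add: fibrewise_balanced_def assignments_eq)
  have "is_arg_min (worst_imbalance_sq (2*p) X sup_magnitude) (\<lambda>W. W \<in> assignments p) W
      \<longleftrightarrow> W \<in> assignments p \<and>
          worst_imbalance_sq (2*p) X sup_magnitude W = ereal ((2 / real (2*p) * ?k)\<^sup>2)" for W
  proof (rule is_arg_min_iff_eq_lower_bound)
    fix W assume W: "W \<in> assignments p"
    have "?k \<le> ?total W" by (intro sum_mono le[OF W])
    then show "ereal ((2 / real (2*p) * ?k)\<^sup>2) \<le> worst_imbalance_sq (2*p) X sup_magnitude W"
      unfolding worst_imbalance_sq_sup_magnitude ereal_less_eq
      by (intro power_mono mult_left_mono) (auto intro!: divide_nonneg_nonneg sum_nonneg)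
  next
    show "worst_imbalance_sq (2*p) X sup_magnitude W0 = ereal ((2 / real (2*p) * ?k)\<^sup>2)"
      unfolding worst_imbalance_sq_sup_magnitude using eq[OF W0'] W0 by simp
  qed (rule W0')
  also have "W \<in> assignments p \<and>
      worst_imbalance_sq (2*p) X sup_magnitude W = ereal ((2 / real (2*p) * ?k)\<^sup>2)
      \<longleftrightarrow> W \<in> fibrewise_balanced ?N X" for W
    unfolding worst_imbalance_sq_sup_magnitude ereal.inject
    using eq[of W] square_eq[of "?total W" ?k]
    by (auto simp: fibrewise_balanced_def assignments_eq sum_nonneg)
  finally have "{W. is_arg_min (worst_imbalance_sq (2*p) X sup_magnitude) (\<lambda>W. W \<in> assignments p) W}
      = fibrewise_balanced ?N X" by blast
  then show ?thesis unfolding psod_def by (rule arg_cong)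
qed

theorem theorem3:
  fixes X :: "nat \<Rightarrow> 'x" and p :: nat
  assumes "p \<ge> 1"
  shows "psod p X sup_magnitude = incomplete_blocking (2 * p) X"
  using psod_sup_magnitude_uniform[OF assms] incomplete_blocking_uniform[of "2 * p" X] by simp

end
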